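(* Let $\delta\colon T\to\mathcal O$ be a $G$-invariant decoration of a cocompact $G$-tree $T$, and let $\delta'\colon T'\to\mathcal O$ be a $G'$-invariant decoration of a cocompact $G'$-tree $T'$. There exists a decoration-preserving isomorphism $\phi\colon T\to T'$ (i.e. a tree isomorphism with $\delta'\circ\phi=\delta$) if and only if $\mathcal S(T,\delta,\mathcal O)=\mathcal S(T',\delta',\mathcal O)$, up to permuting rows and columns within $\mathcal O$-blocks.
   Context: Trees are simplicial of countable valence, groups act on them cocompactly and without inverting an edge. A decoration is a $G$-invariant map $\delta$ from the vertices of $T$ to a set $\mathcal O$ of ornaments. Neighbor refinement: put $\mathcal O_0=\mathcal O$, $\delta_0=\delta$; for $i\ge0$ and a vertex $v$ let $f_{v,i}\colon\mathcal O_i\to\mathbb N\cup\{0,\infty\}$, $f_{v,i}(o)=\#\{w\in\delta_i^{-1}(o): w\text{ adjacent to }v\}$, let $\mathcal O_{i+1}=\mathcal O_0\times(\mathbb N\cup\{0,\infty\})^{\mathcal O_i}$ and $\delta_{i+1}(v)=(\delta_0(v),f_{v,i})$. There is a least $s\ge0$ such that $\delta_{s}$ and $\delta_{s+1}$ define the same partition of the vertices (and then so do all later $\delta_i$); $\delta_s$ is the neighbor refinement of $\delta$. Structure invariant: let $\pi_0\colon\mathcal O_s\to\mathcal O$ be projection to the first coordinate. Choose an ordering of $\operatorname{Im}\delta$ and, for each $o\in\operatorname{Im}\delta$, an ordering of $\pi_0^{-1}(o)\cap\operatorname{Im}\delta_s$; order $\operatorname{Im}\delta_s$ lexicographically, with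 $j$-th element $\mathcal O_s[j]$. $\mathcal S(T,\delta,\mathcal O)$ is the $\#\operatorname{Im}\delta_s\times\#\operatorname{Im}\delta_s$ matrix whose $(j,k)$ entry is the triple consisting of the number (in $\mathbb N\cup\{0,\infty\}$) of vertices in $\delta_s^{-1}(\mathcal O_s[j])$ adjacent to each vertex of $\delta_s^{-1}(\mathcal O_s[k])$, the row ornament $\pi_0(\mathcal O_s[j])$ and the column ornament $\pi_0(\mathcal O_s[k])$. It is a block matrix, the $\mathcal O$-blocks consisting of the entries with given row and column ornaments; it is well defined up to permuting the $\mathcal O$-blocks and (simultaneously) permuting rows and columns within $\mathcal O$-blocks, i.e. up to the choices of orderings. Equality of two structure invariants is understood up to these choices. *)

theory Defs
  imports
    "HOL-Algebra.Group_Action"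
    "HOL-Library.Extended_Nat"
    "HOL-Library.Countable_Set_Type"
    "HOL-Combinatorics.Permutations"
    "Graph_Theory.Graph_Theory"
    "Jordan_Normal_Form.Matrix"
begin

section \<open>Cocompact trees\<close>

text \<open>
  A simplicial tree is a loop-free symmetric digraph without parallel arcs, each unoriented edge
  being the pair of its two orientations. Walking along an edge and back is a directed
  cycle of length 2, so acyclicity only excludes cycles of length at least 3.
  Nonemptiness is part of \<^const>\<open>connected\<close>.
\<close>

definition nbrs :: "'v pair_pre_digraph \<Rightarrow> 'v \<Rightarrow> 'v set" where
  "nbrs T v = {w \<in> pverts T. (v, w) \<in> parcs T}"

definition simplicial_tree :: "'v pair_pre_digraph \<Rightarrow> bool" where
  "simplicial_tree T \<longleftrightarrow>
     pair_bidirected_digraph T \<and>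
     connected (with_proj T) \<and>
     \<not> (\<exists>p. pre_digraph.cycle (with_proj T) p \<and> 3 \<le> length p) \<and>
     (\<forall>v \<in> pverts T. countable (nbrs T v))"

text \<open>Compactness of the quotient graph: finitely many orbits of vertices and of (oriented) edges.\<close>

definition cocompact_tree_action ::
  "('g, 'm) monoid_scheme \<Rightarrow> 'v pair_pre_digraph \<Rightarrow> ('g \<Rightarrow> 'v \<Rightarrow> 'v) \<Rightarrow> bool" where
  "cocompact_tree_action G T \<alpha> \<longleftrightarrow>
     simplicial_tree T \<and>
     group_action G (pverts T) \<alpha> \<and>
     (\<forall>g \<in> carrier G. \<forall>v \<in> pverts T. \<forall>w \<in> pverts T.
        (\<alpha> g v, \<alpha> g w) \<in> parcs T \<longleftrightarrow> (v, w) \<in> parcs T) \<and>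
     \<not> (\<exists>g \<in> carrier G. \<exists>(v, w) \<in> parcs T. \<alpha> g v = w \<and> \<alpha> g w = v) \<and>
     finite (orbits G (pverts T) \<alpha>) \<and>
     finite (orbits G (parcs T) (\<lambda>g. map_prod (\<alpha> g) (\<alpha> g)))"

definition invariant_decoration ::
  "('g, 'm) monoid_scheme \<Rightarrow> 'v pair_pre_digraph \<Rightarrow> ('g \<Rightarrow> 'v \<Rightarrow> 'v) \<Rightarrow> ('v \<Rightarrow> 'o) \<Rightarrow> bool" where
  "invariant_decoration G T \<alpha> \<delta> \<longleftrightarrow> (\<forall>g \<in> carrier G. \<forall>v \<in> pverts T. \<delta> (\<alpha> g v) = \<delta> v)"

definition tree_isomorphism ::
  "'v pair_pre_digraph \<Rightarrow> 'w pair_pre_digraph \<Rightarrow> ('v \<Rightarrow> 'w) \<Rightarrow> bool" where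
  "tree_isomorphism T T' \<phi> \<longleftrightarrow>
     bij_betw \<phi> (pverts T) (pverts T') \<and>
     (\<forall>v \<in> pverts T. \<forall>w \<in> pverts T. (v, w) \<in> parcs T \<longleftrightarrow> (\<phi> v, \<phi> w) \<in> parcs T')"

definition decoration_preserving ::
  "'v pair_pre_digraph \<Rightarrow> ('v \<Rightarrow> 'o) \<Rightarrow> ('w \<Rightarrow> 'o) \<Rightarrow> ('v \<Rightarrow> 'w) \<Rightarrow> bool" where
  "decoration_preserving T \<delta> \<delta>' \<phi> \<longleftrightarrow> (\<forall>v \<in> pverts T. \<delta>' (\<phi> v) = \<delta> v)"


section \<open>Neighbor refinement\<close>

definition ecount :: "'a set \<Rightarrow> enat" where
  "ecount A = (if finite A then enat (card A) else \<infinity>)"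

text \<open>
  One type for all the ornament sets of the refinement process: \<open>Base\<close> embeds the original
  ornaments, and an element \<open>(c, f)\<close> of the \<open>(i+1)\<close>-st ornament set is \<open>Refined c (supp_graph f)\<close>,
  where \<open>f\<close> is recorded by its graph over its support. The support of every \<open>f\<close> that occurs is
  countable because vertices have countable valence; for such functions the encoding is
  injective (lemma \<open>supp_graph_inject\<close> below). The selector \<open>pi0\<close> is the projection to the first
  coordinate (the identity on the original ornaments).
\<close>

datatype 'o ornament =
    Base (pi0: 'o)
  | Refined (pi0: 'o) "('o ornament \<times> enat) cset"

definition supp_graph :: "('a \<Rightarrow> enat) \<Rightarrow> ('a \<times> enat) cset" where
  "supp_graph f = acset {(x, f x) | x. f x \<noteq> 0}"

lemma supp_graph_inject:
  assumes "countable {x. f x \<noteq> 0}" "countable {x. g x \<noteq> 0}"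
  shows "supp_graph f = supp_graph g \<longleftrightarrow> f = g"
proof
  assume eq: "supp_graph f = supp_graph g"
  have "countable ((\<lambda>x. (x, h x)) ` {x. h x \<noteq> 0})" if "countable {x. h x \<noteq> 0}"
    for h :: "'a \<Rightarrow> enat"
    using that by (rule countable_image)
  then have c: "countable {(x, h x) | x. h x \<noteq> 0}" if "countable {x. h x \<noteq> 0}"
    for h :: "'a \<Rightarrow> enat"
    using that by (simp add: setcompr_eq_image)
  have "{(x, f x) | x. f x \<noteq> 0} = {(x, g x) | x. g x \<noteq> 0}"
    using eq c[OF assms(1)] c[OF assms(2)] unfolding supp_graph_def
    by (simp add: acset_inject)
  then have "(f x \<noteq> 0 \<and> y = f x) = (g x \<noteq> 0 \<and> y = g x)" for x y
    by (simp add: set_eq_iff) metis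
  then show "f = g"
    by (metis ext)
qed simp

definition nbr_count :: "'v pair_pre_digraph \<Rightarrow> ('v \<Rightarrow> 'c) \<Rightarrow> 'v \<Rightarrow> 'c \<Rightarrow> enat" where
  "nbr_count T d v c = ecount {w \<in> nbrs T v. d w = c}"

primrec refine :: "'v pair_pre_digraph \<Rightarrow> ('v \<Rightarrow> 'o) \<Rightarrow> nat \<Rightarrow> 'v \<Rightarrow> 'o ornament" where
  "refine T \<delta> 0 = (\<lambda>v. Base (\<delta> v))"
| "refine T \<delta> (Suc i) = (\<lambda>v. Refined (\<delta> v) (supp_graph (nbr_count T (refine T \<delta> i) v)))"

definition fibre_partition :: "'v pair_pre_digraph \<Rightarrow> ('v \<Rightarrow> 'c) \<Rightarrow> 'v set set" where
  "fibre_partition T d = (\<lambda>c. {v \<in> pverts T. d v = c}) ` (d ` pverts T)"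

definition stabilization_step :: "'v pair_pre_digraph \<Rightarrow> ('v \<Rightarrow> 'o) \<Rightarrow> nat" where
  "stabilization_step T \<delta> =
     (LEAST s. fibre_partition T (refine T \<delta> s) = fibre_partition T (refine T \<delta> (Suc s)))"

definition nbr_refinement :: "'v pair_pre_digraph \<Rightarrow> ('v \<Rightarrow> 'o) \<Rightarrow> 'v \<Rightarrow> 'o ornament" where
  "nbr_refinement T \<delta> = refine T \<delta> (stabilization_step T \<delta>)"


section \<open>Structure invariant\<close>

text \<open>
  The choices of orderings: \<open>os\<close> lists the ornaments in the image of \<open>\<delta>\<close>, and \<open>rs c\<close> lists the
  refined ornaments lying over \<open>c\<close>. The lexicographic order is the concatenation of the lists
  \<open>rs c\<close> along \<open>os\<close>.
\<close>

definition ornament_orderings ::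
  "'v pair_pre_digraph \<Rightarrow> ('v \<Rightarrow> 'o) \<Rightarrow> 'o list \<Rightarrow> ('o \<Rightarrow> 'o ornament list) \<Rightarrow> bool" where
  "ornament_orderings T \<delta> os rs \<longleftrightarrow>
     distinct os \<and> set os = \<delta> ` pverts T \<and>
     (\<forall>c \<in> set os. distinct (rs c) \<and>
        set (rs c) = {x \<in> nbr_refinement T \<delta> ` pverts T. pi0 x = c})"

text \<open>
  The number of neighbors of refined ornament \<open>x\<close> is the same for all vertices of refined
  ornament \<open>y\<close>, since the partition is stable under further refinement.
\<close>

definition adjacency_number ::
  "'v pair_pre_digraph \<Rightarrow> ('v \<Rightarrow> 'o) \<Rightarrow> 'o ornament \<Rightarrow> 'o ornament \<Rightarrow> enat" where
  "adjacency_number T \<delta> x y =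
     (THE n. \<forall>v \<in> pverts T. nbr_refinement T \<delta> v = y \<longrightarrow> nbr_count T (nbr_refinement T \<delta>) v x = n)"

type_synonym 'o entry = "enat \<times> 'o \<times> 'o"

definition structure_invariant ::
  "'v pair_pre_digraph \<Rightarrow> ('v \<Rightarrow> 'o) \<Rightarrow> 'o list \<Rightarrow> ('o \<Rightarrow> 'o ornament list) \<Rightarrow> 'o entry mat" where
  "structure_invariant T \<delta> os rs =
     (let xs = concat (map rs os) in
      mat (length xs) (length xs)
        (\<lambda>(j, k). (adjacency_number T \<delta> (xs ! j) (xs ! k), pi0 (xs ! j), pi0 (xs ! k))))"

definition row_ornament :: "'o entry mat \<Rightarrow> nat \<Rightarrow> 'o" where
  "row_ornament A i = fst (snd (A $$ (i, i)))"

text \<open>\<open>B\<close> arises from the square matrix \<open>A\<close> by moving row and column \<open>i\<close> to position \<open>p i\<close>.\<close>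

definition permuted_by :: "(nat \<Rightarrow> nat) \<Rightarrow> 'a mat \<Rightarrow> 'a mat \<Rightarrow> bool" where
  "permuted_by p A B \<longleftrightarrow>
     (\<exists>n. A \<in> carrier_mat n n \<and> B \<in> carrier_mat n n \<and> p permutes {..<n} \<and>
       (\<forall>i < n. \<forall>j < n. B $$ (p i, p j) = A $$ (i, j)))"

text \<open>Moving whole blocks: indices that are consecutive in a block stay consecutive.\<close>

definition permutes_blocks :: "(nat \<Rightarrow> nat) \<Rightarrow> 'o entry mat \<Rightarrow> bool" where
  "permutes_blocks p A \<longleftrightarrow>
     (\<forall>i. Suc i < dim_row A \<longrightarrow> row_ornament A (Suc i) = row_ornament A i \<longrightarrow> p (Suc i) = Suc (p i))"

definition permutes_within_blocks :: "(nat \<Rightarrow> nat) \<Rightarrow> 'o entry mat \<Rightarrow> bool" where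
  "permutes_within_blocks p A \<longleftrightarrow> (\<forall>i < dim_row A. row_ornament A (p i) = row_ornament A i)"

definition equal_up_to_block_permutation :: "'o entry mat \<Rightarrow> 'o entry mat \<Rightarrow> bool" where
  "equal_up_to_block_permutation A B \<longleftrightarrow>
     (\<exists>C p q. permutes_blocks p A \<and> permuted_by p A C \<and>
        permutes_within_blocks q C \<and> permuted_by q C B)"

end

theory Submission
  imports Defs
begin

text \<open>
  An isomorphism preserving the decorations commutes with every step of the refinement, so it
  preserves all the data from which the structure invariant is built. Conversely, the refinement
  stabilizes because the action has finitely many vertex orbits; in the stable colouring the colour
  of a vertex determines how many neighbours it has of each colour. If the structure invariants
  agree, then after a renaming of colours both trees have the same colours with the same neighbour
  counts. Rooting both trees at vertices of equal colour, an isomorphism is then constructed level by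
  level: the children of a vertex are its neighbours minus its parent, so two vertices with equal
  colours and parents of equal colours admit a colour-preserving bijection of their children.
\<close>

section \<open>Colour-preserving bijections\<close>

text \<open>The value \<infinity> of \<open>ecount\<close> does not separate infinite cardinalities;
  countability does, as every countably infinite set is in bijection with the naturals.\<close>

lemma bij_betw_of_ecount_eq:
  assumes "countable A" "countable B" "ecount A = ecount B"
  shows "\<exists>f. bij_betw f A B"
proof (cases "finite A")
  case True
  with assms(3) have "finite B" "card A = card B"
    by (auto simp: ecount_def split: if_splits)
  with True show ?thesis by (rule_tac finite_same_card_bij)
next
  case False
  with assms(3) have "infinite B"
    by (auto simp: ecount_def split: if_splits)
  with False assms(1,2) show ?thesis
    by (metis bij_betw_inv bij_betw_trans to_nat_on_infinite)
qed

lemma ecount_bij_betw: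
  assumes "bij_betw f A B"
  shows "ecount A = ecount B"
  using bij_betw_finite[OF assms] bij_betw_same_card[OF assms] by (simp add: ecount_def)

text \<open>Bijections between the colour classes are glued. Classes of different colours are
  disjoint on both sides, so the union of these bijections is again one.\<close>

lemma colour_bijection:
  assumes "countable A" "countable B"
    and eq: "\<And>c. ecount {x \<in> A. d x = c} = ecount {y \<in> B. d' y = c}"
  obtains f where "bij_betw f A B" "\<And>x. x \<in> A \<Longrightarrow> d' (f x) = d x"
proof -
  have "\<exists>f. bij_betw f {x \<in> A. d x = c} {y \<in> B. d' y = c}" for c
    using assms by (intro bij_betw_of_ecount_eq eq) auto
  then obtain F where F: "\<And>c. bij_betw (F c) {x \<in> A. d x = c} {y \<in> B. d' y = c}"
    by metis
  have mem: "F (d x) x \<in> B" "d' (F (d x) x) = d x" if "x \<in> A" for x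
    using bij_betwE[OF F[of "d x"]] that by auto
  have "inj_on (\<lambda>x. F (d x) x) A"
  proof (rule inj_onI)
    fix x y assume xy: "x \<in> A" "y \<in> A" "F (d x) x = F (d y) y"
    then have "d x = d y" using mem by metis
    with xy show "x = y"
      using bij_betw_imp_inj_on[OF F[of "d x"]] by (auto dest: inj_onD)
  qed
  moreover have "(\<lambda>x. F (d x) x) ` A = B"
  proof (intro equalityI subsetI)
    fix y assume "y \<in> B"
    then have "y \<in> F (d' y) ` {x \<in> A. d x = d' y}"
      using bij_betw_imp_surj_on[OF F[of "d' y"]] by auto
    then obtain x where "x \<in> A" "y = F (d x) x" by auto
    then show "y \<in> (\<lambda>x. F (d x) x) ` A" by blast
  qed (use mem in auto)
  ultimately show ?thesis
    using that[of "\<lambda>x. F (d x) x"] mem by (auto simp: bij_betw_def)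
qed

lemma ecount_colour_bijection:
  assumes "bij_betw f A B" and "\<And>x. x \<in> A \<Longrightarrow> d' (f x) = d x"
  shows "ecount {x \<in> A. d x = c} = ecount {y \<in> B. d' y = c}"
proof -
  have "bij_betw f {x \<in> A. d x = c} {y \<in> B. d' y = c}"
    using assms by (auto simp: bij_betw_def inj_on_def)
  then show ?thesis by (rule ecount_bij_betw)
qed

text \<open>Following \<open>f\<close> by the transposition of \<open>f a\<close> and
  \<open>b\<close> sends \<open>a\<close> to \<open>b\<close>; both swapped elements have the colour
  of \<open>a\<close>, so colours survive. This serves to delete the parents from two sets of
  neighbours.\<close>

lemma colour_bijection_remove:
  assumes "bij_betw f A B" "\<And>x. x \<in> A \<Longrightarrow> d' (f x) = d x"
    and "a \<in> A" "b \<in> B" "d' b = d a"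
  shows "\<exists>g. bij_betw g (A - {a}) (B - {b}) \<and> (\<forall>x \<in> A - {a}. d' (g x) = d x)"
proof -
  define g where "g = transpose (f a) b \<circ> f"
  have "f a \<in> B" using assms by (auto dest: bij_betwE)
  then have "bij_betw (transpose (f a) b) B B"
    using \<open>b \<in> B\<close> by (intro permutes_imp_bij permutes_swap_id)
  then have "bij_betw g A B"
    unfolding g_def by (rule bij_betw_trans[OF assms(1)])
  then have "bij_betw g (A - {a}) (B - {g a})"
    using \<open>a \<in> A\<close> by (auto simp: bij_betw_def inj_on_def)
  moreover have "g a = b" by (simp add: g_def)
  moreover have "d' (g x) = d x" if "x \<in> A - {a}" for x
    using that assms inj_onD[OF bij_betw_imp_inj_on[OF assms(1)], of x a]
    by (auto simp: g_def transpose_def)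
  ultimately show ?thesis by blast
qed

section \<open>Rooted trees\<close>

text \<open>Induction along the walk. Restricting the relation to \<open>S\<close> confines the path
  to \<open>S\<close>, which later keeps it away from chosen vertices outside.\<close>

lemma distinct_path_within:
  assumes "(a, b) \<in> (E \<inter> S \<times> S)\<^sup>*" "a \<in> S"
  shows "\<exists>xs. xs \<noteq> [] \<and> hd xs = a \<and> last xs = b \<and> distinct xs \<and> set xs \<subseteq> S \<and>
    successively (\<lambda>x y. (x, y) \<in> E) xs"
  using assms(1)
proof (induction rule: rtrancl_induct)
  case base
  show ?case using assms(2) by (intro exI[of _ "[a]"]) auto
next
  case (step y z)
  then obtain xs where xs: "xs \<noteq> []" "hd xs = a" "last xs = y" "distinct xs" "set xs \<subseteq> S"
    "successively (\<lambda>x y. (x, y) \<in> E) xs" by blast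
  show ?case
  proof (cases "z \<in> set xs")
    case True
    \<comment> \<open>If the walk returns to a vertex already on the path, the path is cut off
      there.\<close>
    then obtain ys zs where "xs = ys @ z # zs" by (meson split_list)
    then have "xs = (ys @ [z]) @ zs" by simp
    moreover have "hd (ys @ [z]) = hd ((ys @ [z]) @ zs)" by (cases ys) auto
    ultimately show ?thesis
      using xs by (intro exI[of _ "ys @ [z]"]) (auto simp: successively_append_iff)
  next
    case False
    with xs step show ?thesis
      by (intro exI[of _ "xs @ [z]"]) (auto simp: successively_append_iff)
  qed
qed

section \<open>Acyclicity of a tree in terms of vertex lists\<close>

locale locally_countable_tree =
  fixes T :: "'v pair_pre_digraph"
  assumes tree: "simplicial_tree T"
begin

lemma parcs_sym: "(v, w) \<in> parcs T \<Longrightarrow> (w, v) \<in> parcs T"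
  and parcs_irrefl: "(v, v) \<notin> parcs T"
  and parcs_verts: "(v, w) \<in> parcs T \<Longrightarrow> v \<in> pverts T \<and> w \<in> pverts T"
proof -
  interpret pair_bidirected_digraph T
    using tree by (simp add: simplicial_tree_def)
  show "(v, w) \<in> parcs T \<Longrightarrow> (w, v) \<in> parcs T"
    using pair_sym_arcs by (auto simp: symmetric_def dest: symD)
  show "(v, v) \<notin> parcs T" using pair_no_loops by fastforce
  show "(v, w) \<in> parcs T \<Longrightarrow> v \<in> pverts T \<and> w \<in> pverts T"
    using in_arcsD1 in_arcsD2 by blast
qed

lemma countable_nbrs: "v \<in> pverts T \<Longrightarrow> countable (nbrs T v)"
  using tree by (simp add: simplicial_tree_def)

lemma pverts_nonempty: "pverts T \<noteq> {}"
  and rtrancl_parcs: "u \<in> pverts T \<Longrightarrow> v \<in> pverts T \<Longrightarrow> (u, v) \<in> (parcs T)\<^sup>*"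
proof -
  interpret pair_bidirected_digraph T
    using tree by (simp add: simplicial_tree_def)
  have "strongly_connected (with_proj T)"
    using tree pair_sym_arcs
    by (intro symmetric_connected_imp_strongly_connected) (auto simp: simplicial_tree_def)
  then show "pverts T \<noteq> {}"
    "u \<in> pverts T \<Longrightarrow> v \<in> pverts T \<Longrightarrow> (u, v) \<in> (parcs T)\<^sup>*"
    by (auto simp: strongly_connected_def reachable_def intro: rtrancl_on_rtranclI)
qed

text \<open>Passage from lists of vertices to the lists of arcs in which cycles are expressed. The
  vertices of the walk are recorded so that distinctness can be transferred; \<open>y\<close> may be
  \<open>x\<close>.\<close>

lemma cas_closing:
  assumes "successively (\<lambda>x y. (x, y) \<in> parcs T) (x # xs)" "(last (x # xs), y) \<in> parcs T"
  shows "\<exists>p. pre_digraph.cas (with_proj T) x p y \<and> set p \<subseteq> parcs T \<and>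
    pre_digraph.awalk_verts (with_proj T) x p = x # xs @ [y]"
  using assms
proof (induction xs arbitrary: x)
  case Nil
  then show ?case
    by (intro exI[of _ "[(x, y)]"]) (auto simp: pre_digraph.cas.simps pre_digraph.awalk_verts.simps)
next
  case (Cons z xs)
  then obtain p where "pre_digraph.cas (with_proj T) z p y" "set p \<subseteq> parcs T"
    "pre_digraph.awalk_verts (with_proj T) z p = z # xs @ [y]"
    by (auto split: if_splits)
  with Cons.prems show ?case
    by (intro exI[of _ "(x, z) # p"])
      (auto simp: pre_digraph.cas.simps pre_digraph.awalk_verts.simps)
qed

lemma no_cycle:
  assumes "successively (\<lambda>x y. (x, y) \<in> parcs T) xs" "(last xs, hd xs) \<in> parcs T"
    "distinct xs" "3 \<le> length xs"
  shows False
proof -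
  obtain x ys where xs: "xs = x # ys" using assms(4) by (cases xs) auto
  with assms cas_closing[of x ys x]
  obtain p where p: "pre_digraph.cas (with_proj T) x p x" "set p \<subseteq> parcs T"
    "pre_digraph.awalk_verts (with_proj T) x p = x # ys @ [x]" by auto
  \<comment> \<open>With the closing arc there are as many arcs as vertices in \<open>xs\<close>, so
    the bound 3 carries over.\<close>
  have "length p = length xs"
    using p(3) pre_digraph.length_awalk_verts[of "with_proj T" x p] xs by simp
  moreover have "pre_digraph.cycle (with_proj T) p"
    unfolding pre_digraph.cycle_def pre_digraph.awalk_def
    using p assms xs parcs_verts[of "last xs" "hd xs"] \<open>length p = length xs\<close>
    by (intro exI[of _ x]) auto
  ultimately show False
    using assms(4) tree by (auto simp: simplicial_tree_def)
qed

end


section \<open>Rootings given by a level and a parent function\<close>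

text \<open>The edges are exactly the pairs of a vertex and its parent, so \<open>lev\<close> is the
  distance to the root. The value \<open>par r\<close> is meaningless, hence the guards
  \<open>v \<noteq> r\<close>.\<close>

locale rooted_tree =
  fixes T :: "'v pair_pre_digraph" and r :: 'v and lev :: "'v \<Rightarrow> nat" and par :: "'v \<Rightarrow> 'v"
  assumes root: "r \<in> pverts T"
    and lev_eq_0_iff: "v \<in> pverts T \<Longrightarrow> lev v = 0 \<longleftrightarrow> v = r"
    and par_in_verts: "v \<in> pverts T \<Longrightarrow> v \<noteq> r \<Longrightarrow> par v \<in> pverts T"
    and lev_par: "v \<in> pverts T \<Longrightarrow> v \<noteq> r \<Longrightarrow> lev v = Suc (lev (par v))"
    and parcs_iff: "v \<in> pverts T \<Longrightarrow> w \<in> pverts T \<Longrightarrow>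
      (v, w) \<in> parcs T \<longleftrightarrow> (v \<noteq> r \<and> par v = w) \<or> (w \<noteq> r \<and> par w = v)"
begin

definition children :: "'v \<Rightarrow> 'v set" where
  "children v = {w \<in> pverts T. w \<noteq> r \<and> par w = v}"

lemma children_root: "children r = nbrs T r"
  using root by (auto simp: children_def nbrs_def parcs_iff)

lemma children_nonroot:
  assumes "v \<in> pverts T" "v \<noteq> r"
  shows "par v \<in> nbrs T v" "children v = nbrs T v - {par v}"
proof -
  show "par v \<in> nbrs T v"
    using assms par_in_verts by (simp add: nbrs_def parcs_iff)
  have "par v \<notin> children v"
    using assms lev_par[of v] lev_par[of "par v"] by (auto simp: children_def)
  then show "children v = nbrs T v - {par v}"
    using assms by (auto simp: children_def nbrs_def parcs_iff)
qed

end

text \<open>Levels are distances from \<open>r\<close>. A vertex with two neighbours one level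
  lower, or an edge within a level, would close up to a cycle through the vertices nearer to
  \<open>r\<close>; so every edge joins consecutive levels and parents are unique.\<close>

lemma (in locally_countable_tree) exists_rooting:
  assumes r: "r \<in> pverts T"
  shows "\<exists>lev par. rooted_tree T r lev par"
proof -
  let ?E = "parcs T"
  define lev where "lev v = (LEAST n. (r, v) \<in> ?E ^^ n)" for v
  have lev_walk: "(r, v) \<in> ?E ^^ lev v" if "v \<in> pverts T" for v
    unfolding lev_def using rtrancl_parcs[OF r that] rtrancl_imp_relpow LeastI_ex by metis
  have lev_le: "lev v \<le> n" if "(r, v) \<in> ?E ^^ n" for v n
    unfolding lev_def using that by (rule Least_le)
  have lev_0: "lev v = 0 \<longleftrightarrow> v = r" if "v \<in> pverts T" for v
    using lev_walk[OF that] lev_le[of v 0] by auto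
  have lev_Suc: "lev w \<le> Suc (lev v)" if "(v, w) \<in> ?E" for v w
    using that lev_walk[of v] parcs_verts by (intro lev_le) auto
  have lower: "\<exists>u. (u, v) \<in> ?E \<and> Suc (lev u) = lev v" if v: "v \<in> pverts T" "v \<noteq> r" for v
  proof -
    obtain n where n: "lev v = Suc n" using v lev_0 by (cases "lev v") auto
    with lev_walk[OF v(1)] obtain u where u: "(r, u) \<in> ?E ^^ n" "(u, v) \<in> ?E" by auto
    with lev_le lev_Suc[of u v] n have "lev u = n" by fastforce
    with u n show ?thesis by auto
  qed
  \<comment> \<open>\<open>S n\<close> is the ball of radius \<open>n\<close> about
    \<open>r\<close>. It is connected by descending to the root, and a path inside it avoids every
    vertex of level above \<open>n\<close>.\<close>
  define S where "S n = {v \<in> pverts T. lev v \<le> n}" for n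
  have to_root: "(v, r) \<in> (?E \<inter> S n \<times> S n)\<^sup>*" if "v \<in> S n" for v n
    using that
  proof (induction "lev v" arbitrary: v)
    case 0
    then show ?case using lev_0 by (auto simp: S_def)
  next
    case (Suc m)
    then have "v \<in> pverts T" "v \<noteq> r" using lev_0[of v] by (auto simp: S_def)
    then obtain u where u: "(u, v) \<in> ?E" "Suc (lev u) = lev v" using lower by blast
    with Suc have "u \<in> S n" using parcs_verts by (auto simp: S_def)
    with u Suc have "(u, r) \<in> (?E \<inter> S n \<times> S n)\<^sup>*" "(v, u) \<in> ?E \<inter> S n \<times> S n"
      using parcs_sym by auto
    then show ?case by (rule converse_rtrancl_into_rtrancl[rotated])
  qed
  have path: "\<exists>xs. xs \<noteq> [] \<and> hd xs = a \<and> last xs = b \<and> distinct xs \<and> set xs \<subseteq> S n \<and>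
    successively (\<lambda>x y. (x, y) \<in> ?E) xs" if "a \<in> S n" "b \<in> S n" for a b n
  proof (rule distinct_path_within)
    have "sym (?E \<inter> S n \<times> S n)" using parcs_sym by (auto intro: symI)
    then have "(r, b) \<in> (?E \<inter> S n \<times> S n)\<^sup>*"
      using to_root[OF that(2)] sym_rtrancl by (metis symD)
    then show "(a, b) \<in> (?E \<inter> S n \<times> S n)\<^sup>*"
      using to_root[OF that(1)] by (rule rtrancl_trans[rotated])
  qed (use that in auto)
  \<comment> \<open>Two lower neighbours \<open>a\<close>, \<open>b\<close> of \<open>v\<close> are
    joined inside a ball not containing \<open>v\<close>. If \<open>a \<noteq> b\<close>, the path
    has at least two vertices, and adding \<open>v\<close> gives a cycle of length at least
    3.\<close>
  have unique: "a = b" if "(a, v) \<in> ?E" "(b, v) \<in> ?E" "Suc (lev a) = lev v" "Suc (lev b) = lev v"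
    for a b v
  proof (rule ccontr)
    assume "a \<noteq> b"
    have "a \<in> S (lev a)" "b \<in> S (lev a)" using that parcs_verts by (auto simp: S_def)
    then obtain xs where xs: "xs \<noteq> []" "hd xs = a" "last xs = b" "distinct xs" "set xs \<subseteq> S (lev a)"
      "successively (\<lambda>x y. (x, y) \<in> ?E) xs" using path by blast
    have "v \<notin> set xs" using xs(5) that(3) by (auto simp: S_def)
    moreover have "2 \<le> length xs"
      using xs(1-3) \<open>a \<noteq> b\<close> by (cases xs rule: list.exhaust; cases "tl xs") auto
    ultimately show False
      using xs that parcs_sym by (intro no_cycle[of "v # xs"]) (auto simp: successively_Cons)
  qed
  \<comment> \<open>For an edge within a level, one lower neighbour of each end is taken. These may
    coincide; the path between them then has a single vertex, and the cycle still has length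
    3.\<close>
  have differ: "lev a \<noteq> lev b" if "(a, b) \<in> ?E" for a b
  proof
    assume eq: "lev a = lev b"
    have ab: "a \<in> pverts T" "b \<in> pverts T" "a \<noteq> b"
      using that parcs_verts parcs_irrefl by auto
    then have "a \<noteq> r" "b \<noteq> r" using lev_0 eq by metis+
    then obtain a' b' where *: "(a', a) \<in> ?E" "Suc (lev a') = lev a" "(b', b) \<in> ?E" "Suc (lev b') = lev b"
      using lower ab by metis
    then have "a' \<in> S (lev a')" "b' \<in> S (lev a')" using eq parcs_verts by (auto simp: S_def)
    then obtain xs where xs: "xs \<noteq> []" "hd xs = a'" "last xs = b'" "distinct xs"
      "set xs \<subseteq> S (lev a')" "successively (\<lambda>x y. (x, y) \<in> ?E) xs" using path by blast
    have "a \<notin> set xs" "b \<notin> set xs" using xs(5) * eq by (auto simp: S_def)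
    then show False
      using xs * ab that parcs_sym by (intro no_cycle[of "b # a # xs"])
        (auto simp: successively_Cons Suc_le_eq)
  qed
  define par where "par v = (THE u. (u, v) \<in> ?E \<and> Suc (lev u) = lev v)" for v
  have par: "par v = u \<longleftrightarrow> (u, v) \<in> ?E \<and> Suc (lev u) = lev v" if "v \<in> pverts T" "v \<noteq> r" for u v
  proof -
    have "\<exists>!u. (u, v) \<in> ?E \<and> Suc (lev u) = lev v" using lower[OF that] unique by blast
    from theI'[OF this] unique show ?thesis unfolding par_def by blast
  qed
  have "rooted_tree T r lev par"
  proof
    show "lev v = Suc (lev (par v))" "par v \<in> pverts T" if "v \<in> pverts T" "v \<noteq> r" for v
      using par[OF that, of "par v"] parcs_verts by auto
    fix v w assume vw: "v \<in> pverts T" "w \<in> pverts T"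
    have "Suc (lev w) = lev v \<or> Suc (lev v) = lev w" if "(v, w) \<in> ?E"
      using differ[OF that] lev_Suc[OF that] lev_Suc[OF parcs_sym[OF that]] by linarith
    moreover have "v \<noteq> r" if "Suc (lev w) = lev v" for v w
      using that lev_0[OF r] by auto
    ultimately show "(v, w) \<in> ?E \<longleftrightarrow> (v \<noteq> r \<and> par v = w) \<or> (w \<noteq> r \<and> par w = v)"
      using par[OF vw(1), of w] par[OF vw(2), of v] parcs_sym by blast
  qed (use r lev_0 in auto)
  then show ?thesis by blast
qed


section \<open>Level-by-level construction of isomorphisms\<close>

text \<open>The map is defined by recursion on the level, sending children to children by chosen
  bijections. Bijections are requested only for vertices of equal colour that are both roots or have
  parents of equal colour: exactly what is known when the recursion reaches them.\<close>

lemma rooted_tree_isomorphism: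
  assumes "rooted_tree T r lev par" "rooted_tree T' r' lev' par'"
    and root_colour: "d' r' = d r"
    and children: "\<And>u u'. u \<in> pverts T \<Longrightarrow> u' \<in> pverts T' \<Longrightarrow> d' u' = d u \<Longrightarrow>
      u = r \<and> u' = r' \<or> u \<noteq> r \<and> u' \<noteq> r' \<and> d' (par' u') = d (par u) \<Longrightarrow>
      \<exists>f. bij_betw f (rooted_tree.children T r par u) (rooted_tree.children T' r' par' u') \<and>
        (\<forall>v \<in> rooted_tree.children T r par u. d' (f v) = d v)"
  shows "\<exists>\<phi>. tree_isomorphism T T' \<phi> \<and> decoration_preserving T d d' \<phi>"
proof -
  interpret R: rooted_tree T r lev par by fact
  interpret R': rooted_tree T' r' lev' par' by fact
  obtain B where B: "\<And>u u'. u \<in> pverts T \<Longrightarrow> u' \<in> pverts T' \<Longrightarrow> d' u' = d u \<Longrightarrow>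
      u = r \<and> u' = r' \<or> u \<noteq> r \<and> u' \<noteq> r' \<and> d' (par' u') = d (par u) \<Longrightarrow>
      bij_betw (B u u') (R.children u) (R'.children u') \<and>
        (\<forall>v \<in> R.children u. d' (B u u' v) = d v)"
    using children by metis
  \<comment> \<open>\<open>F n\<close> computes the map on level \<open>n\<close>: the constant
    \<open>r'\<close> on level 0, and afterwards the bijection chosen for the parent and its image,
    applied to the vertex.\<close>
  define F where "F = rec_nat (\<lambda>_. r') (\<lambda>_ f v. B (par v) (f (par v)) v)"
  define \<phi> where "\<phi> v = F (lev v) v" for v
  have \<phi>_root: "\<phi> r = r'"
    using R.root R.lev_eq_0_iff[of r] by (simp add: \<phi>_def F_def)
  have \<phi>_step: "\<phi> v = B (par v) (\<phi> (par v)) v" if "v \<in> pverts T" "v \<noteq> r" for v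
    using R.lev_par[OF that] by (simp add: \<phi>_def F_def)
  let ?good = "\<lambda>v. \<phi> v \<in> pverts T' \<and> lev' (\<phi> v) = lev v \<and> d' (\<phi> v) = d v \<and>
    (v \<noteq> r \<longrightarrow> \<phi> v \<noteq> r' \<and> par' (\<phi> v) = \<phi> (par v))"
  have B_of_good: "bij_betw (B u (\<phi> u)) (R.children u) (R'.children (\<phi> u)) \<and>
        (\<forall>v \<in> R.children u. d' (B u (\<phi> u) v) = d v)"
    if "u \<in> pverts T" "?good u" "u \<noteq> r \<Longrightarrow> ?good (par u)" for u
    using that \<phi>_root by (intro B; cases "u = r") auto
  \<comment> \<open>The invariant is carried for the vertex and its parent together: using
    \<open>B\<close> at \<open>par v\<close> requires matching colours at \<open>par v\<close> and,
    unless it is the root, at its parent.\<close>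
  have good: "?good v \<and> (v \<noteq> r \<longrightarrow> ?good (par v))" if "v \<in> pverts T" for v
    using that
  proof (induction "lev v" arbitrary: v rule: less_induct)
    case less
    show ?case
    proof (cases "v = r")
      case True
      then show ?thesis
        using \<phi>_root R'.root root_colour R.root R.lev_eq_0_iff[of r] R'.lev_eq_0_iff[of r'] by auto
    next
      case False
      note p = R.par_in_verts[OF less.prems False] R.lev_par[OF less.prems False]
      have g: "?good (par v)" "par v \<noteq> r \<longrightarrow> ?good (par (par v))"
        using less.hyps[of "par v"] p by auto
      have v: "v \<in> R.children (par v)" using less.prems False by (simp add: R.children_def)
      note b = B_of_good[OF p(1) g(1)]
      have "\<phi> v \<in> R'.children (\<phi> (par v))" "d' (\<phi> v) = d v"
        using b g v \<phi>_step[OF less.prems False] by (auto dest: bij_betwE)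
      moreover from this have "lev' (\<phi> v) = lev v"
        using R'.lev_par[of "\<phi> v"] g p by (auto simp: R'.children_def)
      ultimately show ?thesis using g by (auto simp: R'.children_def)
    qed
  qed
  then have \<phi>_verts: "\<phi> v \<in> pverts T'" and \<phi>_colour: "d' (\<phi> v) = d v" if "v \<in> pverts T" for v
    using that by blast+
  have B_bij: "bij_betw (B u (\<phi> u)) (R.children u) (R'.children (\<phi> u))"
    if "u \<in> pverts T" for u
    using B_of_good[OF that] good[OF that] by auto
  \<comment> \<open>Vertices with equal images lie on one level, and their parents have equal
    images. By induction the parents coincide, and the bijection on their common set of children
    separates the vertices.\<close>
  have inj: "v = w" if "v \<in> pverts T" "w \<in> pverts T" "\<phi> v = \<phi> w" for v w
    using that
  proof (induction "lev v" arbitrary: v w)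
    case 0
    then have "lev w = 0" using good[of v] good[of w] by simp
    with 0 have "v = r" "w = r" using R.lev_eq_0_iff[of v] R.lev_eq_0_iff[of w] by simp_all
    then show ?case by simp
  next
    case (Suc n)
    then have "lev w = Suc n" using good[of v] good[of w] by simp
    with Suc have nr: "v \<noteq> r" "w \<noteq> r"
      using R.lev_eq_0_iff[of v] R.lev_eq_0_iff[of w] by auto
    then have "par' (\<phi> v) = \<phi> (par v)" "par' (\<phi> w) = \<phi> (par w)"
      using good[OF Suc.prems(1)] good[OF Suc.prems(2)] by simp_all
    then have "\<phi> (par v) = \<phi> (par w)" using Suc.prems(3) by simp
    moreover have "n = lev (par v)"
      using Suc.hyps(2) R.lev_par[OF Suc.prems(1) nr(1)] by simp
    ultimately have par: "par v = par w"
      using R.par_in_verts Suc.prems(1,2) nr by (intro Suc.hyps(1)) simp_all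
    have "v \<in> R.children (par v)" "w \<in> R.children (par v)"
      using Suc.prems nr par by (auto simp: R.children_def)
    moreover have "B (par v) (\<phi> (par v)) v = B (par v) (\<phi> (par v)) w"
      using \<phi>_step[OF Suc.prems(1) nr(1)] \<phi>_step[OF Suc.prems(2) nr(2)] Suc.prems(3) par by simp
    ultimately show ?case
      using B_bij[OF R.par_in_verts[OF Suc.prems(1) nr(1)]]
      by (meson bij_betw_imp_inj_on inj_onD)
  qed
  \<comment> \<open>A preimage of the parent exists by induction on the level; the bijection on its
    children then reaches \<open>v'\<close>.\<close>
  have surj: "v' \<in> \<phi> ` pverts T" if "v' \<in> pverts T'" for v'
    using that
  proof (induction "lev' v'" arbitrary: v' rule: less_induct)
    case less
    show ?case
    proof (cases "v' = r'")
      case True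
      then show ?thesis using \<phi>_root R.root by blast
    next
      case False
      then have "par' v' \<in> \<phi> ` pverts T"
        using less R'.lev_par R'.par_in_verts by auto
      then obtain u where u: "u \<in> pverts T" "par' v' = \<phi> u" by blast
      then have "v' \<in> R'.children (\<phi> u)"
        using less.prems False by (simp add: R'.children_def)
      then obtain v where "v \<in> R.children u" "v' = B u (\<phi> u) v"
        using bij_betw_imp_surj_on[OF B_bij[OF u(1)]] by auto
      then have "v \<in> pverts T" "v' = \<phi> v"
        using \<phi>_step by (auto simp: R.children_def)
      then show ?thesis by blast
    qed
  qed
  have "bij_betw \<phi> (pverts T) (pverts T')"
    using inj surj \<phi>_verts by (auto simp: bij_betw_def inj_on_def)
  moreover have "(v, w) \<in> parcs T \<longleftrightarrow> (\<phi> v, \<phi> w) \<in> parcs T'"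
    if vw: "v \<in> pverts T" "w \<in> pverts T" for v w
  proof -
    have "v \<noteq> r \<and> par v = w \<longleftrightarrow> \<phi> v \<noteq> r' \<and> par' (\<phi> v) = \<phi> w"
      if "v \<in> pverts T" "w \<in> pverts T" for v w
    proof (cases "v = r")
      case False
      then have "\<phi> v \<noteq> r'" "par' (\<phi> v) = \<phi> (par v)" using good[OF that(1)] by auto
      moreover have "\<phi> (par v) = \<phi> w \<longleftrightarrow> par v = w"
        using inj[OF R.par_in_verts[OF that(1) False] that(2)] by blast
      ultimately show ?thesis using False by simp
    qed (simp add: \<phi>_root)
    then show ?thesis
      using R.parcs_iff[OF vw] R'.parcs_iff[of "\<phi> v" "\<phi> w"] \<phi>_verts vw by blast
  qed
  ultimately show ?thesis
    using \<phi>_colour by (auto simp: tree_isomorphism_def decoration_preserving_def)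
qed

text \<open>The trees are rooted at vertices of one colour. Equal counts give colour-preserving
  bijections of neighbours; below the roots the two parents, which have equal colours, are removed
  to obtain bijections of children.\<close>

lemma isomorphism_of_equal_nbr_counts:
  assumes "simplicial_tree T" "simplicial_tree T'"
    and img: "d ` pverts T = d' ` pverts T'"
    and eq: "\<And>v v' c. v \<in> pverts T \<Longrightarrow> v' \<in> pverts T' \<Longrightarrow> d' v' = d v \<Longrightarrow>
      nbr_count T d v c = nbr_count T' d' v' c"
  shows "\<exists>\<phi>. tree_isomorphism T T' \<phi> \<and> decoration_preserving T d d' \<phi>"
proof -
  interpret T: locally_countable_tree T by standard fact
  interpret T': locally_countable_tree T' by standard fact
  obtain r where r: "r \<in> pverts T" using T.pverts_nonempty by blast
  then obtain r' where r': "r' \<in> pverts T'" "d' r' = d r" using img by (metis imageE imageI)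
  obtain lev par where "rooted_tree T r lev par" using T.exists_rooting[OF r] by blast
  then interpret R: rooted_tree T r lev par .
  obtain lev' par' where "rooted_tree T' r' lev' par'" using T'.exists_rooting[OF r'(1)] by blast
  then interpret R': rooted_tree T' r' lev' par' .
  show ?thesis
  proof (rule rooted_tree_isomorphism)
    fix u u' assume u: "u \<in> pverts T" "u' \<in> pverts T'" "d' u' = d u"
      and cases: "u = r \<and> u' = r' \<or> u \<noteq> r \<and> u' \<noteq> r' \<and> d' (par' u') = d (par u)"
    obtain f where f: "bij_betw f (nbrs T u) (nbrs T' u')" "\<And>x. x \<in> nbrs T u \<Longrightarrow> d' (f x) = d x"
      using colour_bijection[OF T.countable_nbrs[OF u(1)] T'.countable_nbrs[OF u(2)], of d d']
        eq[OF u] by (auto simp: nbr_count_def)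
    from cases show "\<exists>f. bij_betw f (R.children u) (R'.children u') \<and>
      (\<forall>v \<in> R.children u. d' (f v) = d v)"
    proof
      assume "u = r \<and> u' = r'"
      then show ?thesis using f R.children_root R'.children_root by auto
    next
      assume *: "u \<noteq> r \<and> u' \<noteq> r' \<and> d' (par' u') = d (par u)"
      have ch: "par u \<in> nbrs T u" "R.children u = nbrs T u - {par u}"
        "par' u' \<in> nbrs T' u'" "R'.children u' = nbrs T' u' - {par' u'}"
        using R.children_nonroot[of u] R'.children_nonroot[of u'] u * by auto
      show ?thesis
        unfolding ch(2,4) by (rule colour_bijection_remove[OF f(1)]) (use f ch * in auto)
    qed
  qed (fact r' R.rooted_tree_axioms R'.rooted_tree_axioms)+
qed


section \<open>Stabilization of the neighbor refinement\<close>

lemma nbr_count_isomorphism: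
  assumes "tree_isomorphism T T' \<phi>" "\<And>v. v \<in> pverts T \<Longrightarrow> d' (\<phi> v) = d v" "v \<in> pverts T"
  shows "nbr_count T' d' (\<phi> v) = nbr_count T d v"
proof
  fix c
  have "\<phi> ` nbrs T v = nbrs T' (\<phi> v)"
  proof (intro equalityI subsetI)
    fix y assume y: "y \<in> nbrs T' (\<phi> v)"
    then have "y \<in> \<phi> ` pverts T"
      using assms(1) by (auto simp: tree_isomorphism_def bij_betw_def nbrs_def)
    then obtain x where "x \<in> pverts T" "y = \<phi> x" by blast
    with y show "y \<in> \<phi> ` nbrs T v"
      using assms(1,3) by (auto simp: tree_isomorphism_def nbrs_def)
  qed (use assms(1,3) in \<open>auto simp: tree_isomorphism_def bij_betw_def nbrs_def\<close>)
  moreover have "inj_on \<phi> (nbrs T v)"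
    using assms(1) by (auto simp: tree_isomorphism_def bij_betw_def nbrs_def inj_on_def)
  ultimately have "bij_betw \<phi> (nbrs T v) (nbrs T' (\<phi> v))"
    by (simp add: bij_betw_def)
  then show "nbr_count T' d' (\<phi> v) c = nbr_count T d v c"
    unfolding nbr_count_def
    by (rule ecount_colour_bijection[symmetric]) (use assms(2) in \<open>auto simp: nbrs_def\<close>)
qed

lemma nbr_count_cong:
  assumes "\<And>w. w \<in> pverts T \<Longrightarrow> d w = c \<longleftrightarrow> e w = b"
  shows "nbr_count T d v c = nbr_count T e v b"
proof -
  have "{w \<in> nbrs T v. d w = c} = {w \<in> nbrs T v. e w = b}"
    using assms by (auto simp: nbrs_def)
  then show ?thesis by (simp add: nbr_count_def)
qed

lemma nbr_count_eq_0:
  assumes "c \<notin> d ` pverts T"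
  shows "nbr_count T d v c = 0"
proof -
  have "{w \<in> nbrs T v. d w = c} = {}" using assms by (auto simp: nbrs_def)
  then show ?thesis by (simp only: nbr_count_def ecount_def) (simp add: zero_enat_def)
qed

text \<open>Ornaments record only colours and counts, never vertices. They can therefore be compared
  between different trees, and agree literally along an isomorphism.\<close>

lemma refine_isomorphism:
  assumes "tree_isomorphism T T' \<phi>" "decoration_preserving T \<delta> \<delta>' \<phi>" "v \<in> pverts T"
  shows "refine T' \<delta>' i (\<phi> v) = refine T \<delta> i v"
  using assms(3)
proof (induction i arbitrary: v)
  case 0
  then show ?case using assms(2) by (simp add: decoration_preserving_def)
next
  case (Suc i)
  then show ?case
    using nbr_count_isomorphism[OF assms(1), of "refine T' \<delta>' i" "refine T \<delta> i" v] assms(2)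
    by (simp add: decoration_preserving_def)
qed

lemma fibre_partition_eq_iff:
  "fibre_partition T d = fibre_partition T e \<longleftrightarrow>
    (\<forall>v \<in> pverts T. \<forall>w \<in> pverts T. d v = d w \<longleftrightarrow> e v = e w)" (is "_ \<longleftrightarrow> ?R")
proof
  \<comment> \<open>The partition determines which vertices share a colour: those lying in a common
    class.\<close>
  have *: "f v = f w \<longleftrightarrow> (\<exists>P \<in> fibre_partition T f. v \<in> P \<and> w \<in> P)"
    if "v \<in> pverts T" "w \<in> pverts T" for v w and f :: "'a \<Rightarrow> 'z"
    using that by (auto simp: fibre_partition_def)
  assume "fibre_partition T d = fibre_partition T e"
  with *[of _ _ d] *[of _ _ e] show ?R by simp
next
  assume R: ?R
  have "fibre_partition T d = (\<lambda>u. {v \<in> pverts T. d v = d u}) ` pverts T"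
    by (auto simp: fibre_partition_def)
  also have "\<dots> = (\<lambda>u. {v \<in> pverts T. e v = e u}) ` pverts T"
    using R by (intro image_cong) auto
  also have "\<dots> = fibre_partition T e"
    by (auto simp: fibre_partition_def)
  finally show "fibre_partition T d = fibre_partition T e" .
qed

text \<open>Whether stage \<open>s\<close> is stable depends only on which vertices share ornaments
  at stages \<open>s\<close> and \<open>Suc s\<close>, so both trees stop refining at the same
  stage.\<close>

lemma stabilization_step_isomorphism:
  assumes "tree_isomorphism T T' \<phi>" "decoration_preserving T \<delta> \<delta>' \<phi>"
  shows "stabilization_step T' \<delta>' = stabilization_step T \<delta>"
proof -
  have img: "pverts T' = \<phi> ` pverts T"
    using assms(1) by (auto simp: tree_isomorphism_def bij_betw_def)
  show ?thesis
    unfolding stabilization_step_def fibre_partition_eq_iff img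
    by (simp add: refine_isomorphism[OF assms] del: refine.simps)
qed

lemma nbr_refinement_isomorphism:
  assumes "tree_isomorphism T T' \<phi>" "decoration_preserving T \<delta> \<delta>' \<phi>" "v \<in> pverts T"
  shows "nbr_refinement T' \<delta>' (\<phi> v) = nbr_refinement T \<delta> v"
  using refine_isomorphism[OF assms] stabilization_step_isomorphism[OF assms(1,2)]
  by (simp add: nbr_refinement_def)

lemma nbr_refinement_image_isomorphism:
  assumes "tree_isomorphism T T' \<phi>" "decoration_preserving T \<delta> \<delta>' \<phi>"
  shows "nbr_refinement T' \<delta>' ` pverts T' = nbr_refinement T \<delta> ` pverts T"
proof -
  have "pverts T' = \<phi> ` pverts T"
    using assms(1) by (auto simp: tree_isomorphism_def bij_betw_def)
  then show ?thesis
    using nbr_refinement_isomorphism[OF assms] by (auto simp: image_image intro!: image_cong)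
qed

text \<open>The two definite descriptions have equivalent conditions, so they agree for all pairs of
  ornaments, even for those that do not occur in the trees.\<close>

lemma adjacency_number_isomorphism:
  assumes "tree_isomorphism T T' \<phi>" "decoration_preserving T \<delta> \<delta>' \<phi>"
  shows "adjacency_number T' \<delta>' = adjacency_number T \<delta>"
proof (intro ext)
  fix x y
  have img: "pverts T' = \<phi> ` pverts T"
    using assms(1) by (auto simp: tree_isomorphism_def bij_betw_def)
  have "nbr_count T' (nbr_refinement T' \<delta>') (\<phi> v) = nbr_count T (nbr_refinement T \<delta>) v"
    if "v \<in> pverts T" for v
    by (rule nbr_count_isomorphism[OF assms(1) _ that]) (rule nbr_refinement_isomorphism[OF assms])
  then show "adjacency_number T' \<delta>' x y = adjacency_number T \<delta> x y"
    unfolding adjacency_number_def img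
    by (simp add: nbr_refinement_isomorphism[OF assms])
qed

lemma pi0_refine [simp]: "pi0 (refine T \<delta> i v) = \<delta> v"
  by (cases i) auto

lemma pi0_nbr_refinement [simp]: "pi0 (nbr_refinement T \<delta> v) = \<delta> v"
  by (simp add: nbr_refinement_def)

section \<open>Monotonicity and stabilization of the refinement\<close>

context locally_countable_tree
begin

text \<open>Countable valence enters here: only colours of neighbours have nonzero count, so
  supports are countable and \<open>supp_graph\<close> loses no information.\<close>

lemma refine_Suc_eq_iff:
  assumes "v \<in> pverts T" "w \<in> pverts T"
  shows "refine T \<delta> (Suc i) v = refine T \<delta> (Suc i) w \<longleftrightarrow>
    \<delta> v = \<delta> w \<and> nbr_count T (refine T \<delta> i) v = nbr_count T (refine T \<delta> i) w"
proof -
  have "countable {c. nbr_count T (refine T \<delta> i) u c \<noteq> 0}" if "u \<in> pverts T" for u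
  proof (rule countable_subset)
    show "countable (refine T \<delta> i ` nbrs T u)" using countable_nbrs[OF that] by simp
    have "ecount {} = 0" by (simp add: ecount_def zero_enat_def)
    moreover have "{w \<in> nbrs T u. refine T \<delta> i w = c} = {}" if "c \<notin> refine T \<delta> i ` nbrs T u" for c
      using that by auto
    ultimately show "{c. nbr_count T (refine T \<delta> i) u c \<noteq> 0} \<subseteq> refine T \<delta> i ` nbrs T u"
      unfolding nbr_count_def by (metis (mono_tags, lifting) mem_Collect_eq subsetI)
  qed
  then show ?thesis using assms by (simp add: supp_graph_inject)
qed

text \<open>
  Summing the counts of the finer colours, possibly infinitely many, is replaced by choosing a
  colour-preserving bijection between the two sets of neighbours.
\<close>

lemma nbr_count_coarsen:
  assumes "v \<in> pverts T" "w \<in> pverts T" "nbr_count T e v = nbr_count T e w"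
    and "\<And>x y. x \<in> pverts T \<Longrightarrow> y \<in> pverts T \<Longrightarrow> e x = e y \<Longrightarrow> d x = d y"
  shows "nbr_count T d v = nbr_count T d w"
proof
  fix c
  obtain f where f: "bij_betw f (nbrs T v) (nbrs T w)" "\<And>x. x \<in> nbrs T v \<Longrightarrow> e (f x) = e x"
    using colour_bijection[OF countable_nbrs[OF assms(1)] countable_nbrs[OF assms(2)], of e e]
      fun_cong[OF assms(3)] unfolding nbr_count_def by blast
  have "d (f x) = d x" if "x \<in> nbrs T v" for x
    using f that bij_betwE[OF f(1)] by (intro assms(4)) (auto simp: nbrs_def)
  then show "nbr_count T d v c = nbr_count T d w c"
    unfolding nbr_count_def by (intro ecount_colour_bijection[OF f(1)])
qed

text \<open>An ornament of stage \<open>Suc i\<close> contains the original ornament and the counts,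
  but not the ornament of stage \<open>i\<close>. Hence the induction: if stage \<open>Suc i\<close>
  refines stage \<open>i\<close>, counts of the finer colours determine counts of the coarser
  ones.\<close>

lemma refine_mono:
  assumes "v \<in> pverts T" "w \<in> pverts T" "refine T \<delta> (Suc i) v = refine T \<delta> (Suc i) w"
  shows "refine T \<delta> i v = refine T \<delta> i w"
  using assms
proof (induction i arbitrary: v w)
  case 0
  then show ?case by simp
next
  case (Suc i)
  note v = Suc.prems(1) and w = Suc.prems(2)
  have "nbr_count T (refine T \<delta> (Suc i)) v = nbr_count T (refine T \<delta> (Suc i)) w" "\<delta> v = \<delta> w"
    using Suc.prems(3) unfolding refine_Suc_eq_iff[OF v w] by auto
  moreover have "nbr_count T (refine T \<delta> i) v = nbr_count T (refine T \<delta> i) w"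
    by (rule nbr_count_coarsen[OF v w calculation(1)]) (rule Suc.IH)
  ultimately show ?case
    unfolding refine_Suc_eq_iff[OF v w] by blast
qed

end

text \<open>A member of least cardinality contains its successor and is no larger, so the two are
  equal.\<close>

lemma decreasing_finite_sets_stabilize:
  assumes "finite (A 0)" "\<And>i. A (Suc i) \<subseteq> A i"
  shows "\<exists>s. A s = A (Suc s)"
proof -
  have fin: "finite (A i)" for i
    using assms by (induction i) (auto intro: finite_subset)
  obtain s where "\<And>i. card (A s) \<le> card (A i)"
    using ex_has_least_nat[of "\<lambda>_. True" _ "\<lambda>i. card (A i)"] by auto
  then show ?thesis using card_seteq[OF fin assms(2)] by metis
qed

lemma action_isomorphism:
  assumes "cocompact_tree_action G T \<alpha>" "g \<in> carrier G"
  shows "tree_isomorphism T T (\<alpha> g)"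
proof -
  interpret group_action G "pverts T" \<alpha>
    using assms by (simp add: cocompact_tree_action_def)
  show ?thesis
    using assms surj_prop inj_prop
    by (simp add: tree_isomorphism_def cocompact_tree_action_def bij_betw_def)
qed

text \<open>Group elements are decoration-preserving automorphisms, so ornaments of every stage are
  constant on orbits. Cocompactness leaves finitely many orbits, and a decreasing sequence of
  relations on a finite set becomes stationary.\<close>

lemma refinement_stabilizes:
  assumes act: "cocompact_tree_action G T \<alpha>" and inv: "invariant_decoration G T \<alpha> \<delta>"
  shows "fibre_partition T (nbr_refinement T \<delta>) =
    fibre_partition T (refine T \<delta> (Suc (stabilization_step T \<delta>)))"
proof -
  interpret locally_countable_tree T
    using act by unfold_locales (simp add: cocompact_tree_action_def)
  interpret group_action G "pverts T" \<alpha>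
    using act by (simp add: cocompact_tree_action_def)
  \<comment> \<open>One representative per vertex orbit. The choice operator is applied to the orbit
    as a set, so the same expression recovers the representative of a given vertex below.\<close>
  define R where "R = (\<lambda>X. SOME v. v \<in> X) ` orbits G (pverts T) \<alpha>"
  have finR: "finite R" using act by (simp add: R_def cocompact_tree_action_def)
  have rep: "\<exists>u \<in> R. u \<in> pverts T \<and> (\<forall>i. refine T \<delta> i u = refine T \<delta> i v)"
    if v: "v \<in> pverts T" for v
  proof -
    let ?u = "SOME u. u \<in> Group_Action.orbit G \<alpha> v"
    have "?u \<in> Group_Action.orbit G \<alpha> v" using orbit_refl[OF v] by (rule someI)
    then obtain g where g: "g \<in> carrier G" "?u = \<alpha> g v" by (auto simp: Group_Action.orbit_def)
    then have "refine T \<delta> i ?u = refine T \<delta> i v" for i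
      using inv v by (simp add: refine_isomorphism[OF action_isomorphism[OF act]]
          decoration_preserving_def invariant_decoration_def)
    moreover have "?u \<in> R" using v by (auto simp: R_def orbits_def)
    moreover have "?u \<in> pverts T" using element_image[OF g(1) v] g(2) by simp
    ultimately show ?thesis by blast
  qed
  \<comment> \<open>\<open>K i\<close> is the relation of sharing the ornament of stage
    \<open>i\<close>, restricted to representatives; it decreases with \<open>i\<close> because the
    stages become finer.\<close>
  define K where "K i = {(u, v). u \<in> R \<inter> pverts T \<and> v \<in> R \<inter> pverts T \<and>
    refine T \<delta> i u = refine T \<delta> i v}" for i
  have "finite (K 0)"
    using finR by (rule_tac finite_subset[of _ "R \<times> R"]) (auto simp: K_def)
  moreover have "K (Suc i) \<subseteq> K i" for i
    unfolding K_def using refine_mono by blast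
  ultimately obtain s where s: "K s = K (Suc s)"
    using decreasing_finite_sets_stabilize[of K] by blast
  have "refine T \<delta> s v = refine T \<delta> s w \<longleftrightarrow> refine T \<delta> (Suc s) v = refine T \<delta> (Suc s) w"
    if vw: "v \<in> pverts T" "w \<in> pverts T" for v w
  proof -
    obtain v' where v': "v' \<in> R" "v' \<in> pverts T" "\<And>i. refine T \<delta> i v' = refine T \<delta> i v"
      using rep[OF vw(1)] by blast
    obtain w' where w': "w' \<in> R" "w' \<in> pverts T" "\<And>i. refine T \<delta> i w' = refine T \<delta> i w"
      using rep[OF vw(2)] by blast
    have "(v', w') \<in> K s \<longleftrightarrow> (v', w') \<in> K (Suc s)" using s by simp
    with v' w' show ?thesis by (simp add: K_def del: refine.simps)
  qed
  then have "fibre_partition T (refine T \<delta> s) = fibre_partition T (refine T \<delta> (Suc s))"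
    unfolding fibre_partition_eq_iff by (intro ballI)
  \<comment> \<open>Some stable stage exists, so the least one, at which the refinement stops, is
    stable as well.\<close>
  then show ?thesis
    unfolding nbr_refinement_def stabilization_step_def
    by (rule LeastI[where P = "\<lambda>s. fibre_partition T (refine T \<delta> s) = fibre_partition T (refine T \<delta> (Suc s))"])
qed

text \<open>By stability, vertices with the same refined ornament also share the ornament of the
  next stage, which contains the counts. The value is thus unique, and \<open>v\<close> itself
  realizes it.\<close>

lemma adjacency_number_nbr_refinement:
  assumes act: "cocompact_tree_action G T \<alpha>" and inv: "invariant_decoration G T \<alpha> \<delta>"
    and v: "v \<in> pverts T"
  shows "adjacency_number T \<delta> x (nbr_refinement T \<delta> v) = nbr_count T (nbr_refinement T \<delta>) v x"
proof -
  interpret locally_countable_tree T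
    using act by unfold_locales (simp add: cocompact_tree_action_def)
  have "nbr_count T (nbr_refinement T \<delta>) w = nbr_count T (nbr_refinement T \<delta>) v"
    if w: "w \<in> pverts T" "nbr_refinement T \<delta> w = nbr_refinement T \<delta> v" for w
  proof -
    have "refine T \<delta> (Suc (stabilization_step T \<delta>)) w = refine T \<delta> (Suc (stabilization_step T \<delta>)) v"
      using refinement_stabilizes[OF act inv, unfolded fibre_partition_eq_iff, rule_format, OF w(1) v]
        w(2) by (rule iffD1)
    then show ?thesis
      unfolding refine_Suc_eq_iff[OF w(1) v] nbr_refinement_def by (rule conjunct2)
  qed
  then have "nbr_count T (nbr_refinement T \<delta>) w x = nbr_count T (nbr_refinement T \<delta>) v x"
    if "w \<in> pverts T" "nbr_refinement T \<delta> w = nbr_refinement T \<delta> v" for w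
    using that by metis
  then show ?thesis
    unfolding adjacency_number_def using v by (intro the_equality) blast+
qed


section \<open>Orderings and block permutations\<close>

locale block_lists =
  fixes key :: "'a \<Rightarrow> 'o" and os :: "'o list" and rs :: "'o \<Rightarrow> 'a list"
  assumes distinct_os: "distinct os"
    and distinct_rs: "c \<in> set os \<Longrightarrow> distinct (rs c)"
    and key_rs: "c \<in> set os \<Longrightarrow> x \<in> set (rs c) \<Longrightarrow> key x = c"
begin

lemma distinct_blocks: "distinct (concat (map rs os))"
proof -
  have "distinct (concat (map rs cs))" if "distinct cs" "set cs \<subseteq> set os" for cs
    using that
  proof (induction cs)
    case (Cons c cs)
    have "set (rs c) \<inter> set (rs c') = {}" if "c' \<in> set cs" for c'
      using that Cons.prems key_rs[of c] key_rs[of c'] by fastforce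
    with Cons show ?case using distinct_rs[of c] by auto
  qed simp
  then show ?thesis using distinct_os by blast
qed

text \<open>The sequence of keys depends only on the order of the blocks and on their lengths, not
  on the order inside the blocks.\<close>

lemma map_key_blocks: "map key (concat (map rs os)) = concat (map (\<lambda>c. replicate (length (rs c)) c) os)"
proof -
  have "map key (rs c) = replicate (length (rs c)) c" if "c \<in> set os" for c
    using key_rs[OF that] map_cong[of "rs c" "rs c" key "\<lambda>_. c"] by (simp add: map_replicate_const)
  then show ?thesis by (simp add: map_concat cong: map_cong)
qed

text \<open>The offset \<open>m\<close> is the total length of the preceding blocks; distinctness of
  \<open>os\<close> keeps the key \<open>c\<close> out of all other blocks.\<close>

lemma nth_blocks:
  assumes "c \<in> set os"
  obtains m where "\<And>j. j < length (rs c) \<Longrightarrow>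
      m + j < length (concat (map rs os)) \<and> concat (map rs os) ! (m + j) = rs c ! j"
    and "\<And>i. i < length (concat (map rs os)) \<Longrightarrow> key (concat (map rs os) ! i) = c \<Longrightarrow>
      m \<le> i \<and> i - m < length (rs c)"
proof -
  obtain as bs where os: "os = as @ c # bs" using assms by (meson split_list)
  define A where "A = concat (map rs as)"
  define B where "B = concat (map rs bs)"
  have key: "key x \<noteq> c" if "x \<in> set A \<union> set B" for x
  proof -
    from that obtain c' where c': "c' \<in> set as \<union> set bs" "x \<in> set (rs c')"
      by (auto simp: A_def B_def)
    then have "key x = c'" using key_rs[of c' x] by (auto simp: os)
    then show ?thesis using c'(1) distinct_os by (auto simp: os)
  qed
  have eq: "concat (map rs os) = A @ rs c @ B" by (simp add: os A_def B_def)
  show ?thesis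
  proof (rule that[of "length A", unfolded eq])
    show "length A + j < length (A @ rs c @ B) \<and> (A @ rs c @ B) ! (length A + j) = rs c ! j"
      if "j < length (rs c)" for j
      using that by (simp add: nth_append)
    fix i assume i: "i < length (A @ rs c @ B)" "key ((A @ rs c @ B) ! i) = c"
    have "\<not> i < length A"
      using key[of "A ! i"] i(2) by (auto simp: nth_append)
    moreover have "\<not> length A + length (rs c) \<le> i"
      using key[of "B ! (i - length A - length (rs c))"] i
      by (auto simp: nth_append split: if_splits)
    ultimately show "length A \<le> i \<and> i - length A < length (rs c)" by linarith
  qed
qed

end

text \<open>Both concatenations use the same lists \<open>rs\<close>, so an element has the same
  offset within its block in each of them. Distinctness then identifies \<open>a\<close> and
  \<open>b\<close> as positions with consecutive offsets.\<close>

lemma consecutive_in_reordered_blocks: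
  fixes os os' :: "'o list" and rs :: "'o \<Rightarrow> 'a list"
  assumes "block_lists key os rs" "block_lists key os' rs" "set os = set os'"
  defines "xs \<equiv> concat (map rs os)" and "ys \<equiv> concat (map rs os')"
  assumes i: "Suc i < length xs" "key (xs ! Suc i) = key (xs ! i)"
    and a: "a < length ys" "ys ! a = xs ! i" and b: "b < length ys" "ys ! b = xs ! Suc i"
  shows "b = Suc a"
proof -
  interpret X: block_lists key os rs by fact
  interpret Y: block_lists key os' rs by fact
  define c where "c = key (xs ! i)"
  have "xs ! i \<in> set xs" using i(1) by simp
  then have c: "c \<in> set os" "c \<in> set os'"
    using X.key_rs assms(3) by (auto simp: xs_def c_def)
  obtain m where m: "\<And>j. j < length (rs c) \<Longrightarrow> m + j < length xs \<and> xs ! (m + j) = rs c ! j"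
    "\<And>i. i < length xs \<Longrightarrow> key (xs ! i) = c \<Longrightarrow> m \<le> i \<and> i - m < length (rs c)"
    using X.nth_blocks[OF c(1)] unfolding xs_def by blast
  obtain k where k: "\<And>j. j < length (rs c) \<Longrightarrow> k + j < length ys \<and> ys ! (k + j) = rs c ! j"
    using Y.nth_blocks[OF c(2)] unfolding ys_def by blast
  define j where "j = i - m"
  have mi: "m \<le> i" using m(2)[of i] i(1) c_def by simp
  have j: "j < length (rs c)" using m(2)[of i] i(1) c_def j_def by simp
  have sj: "Suc j < length (rs c)"
    using m(2)[of "Suc i"] i c_def mi j_def by (simp add: Suc_diff_le)
  have "xs ! i = rs c ! j" "xs ! Suc i = rs c ! Suc j"
    using m(1)[OF j] m(1)[OF sj] mi by (auto simp: j_def)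
  then have eq: "ys ! a = ys ! (k + j)" "ys ! b = ys ! (k + Suc j)"
    using a(2) b(2) k[OF j] k[OF sj] by simp_all
  have dist: "distinct ys" unfolding ys_def by (rule Y.distinct_blocks)
  have "a = k + j"
    using nth_eq_iff_index_eq[OF dist a(1) k[OF j, THEN conjunct1]] eq(1) by (rule iffD1)
  moreover have "b = k + Suc j"
    using nth_eq_iff_index_eq[OF dist b(1) k[OF sj, THEN conjunct1]] eq(2) by (rule iffD1)
  ultimately show ?thesis by simp
qed

lemma reordering_permutation:
  assumes "distinct xs" "distinct ys" "set xs = set ys"
  obtains p where "p permutes {..<length xs}" "\<And>i. i < length xs \<Longrightarrow> ys ! p i = xs ! i"
proof -
  have "mset xs = mset ys" using assms by (simp add: set_eq_iff_mset_eq_distinct)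
  moreover from this have "length xs = length ys" by (rule mset_eq_length)
  ultimately obtain p where "p permutes {..<length ys}" "permute_list p ys = xs"
    using mset_eq_permutation by blast
  then show ?thesis
    using that[of p] \<open>length xs = length ys\<close> permute_list_nth by metis
qed

section \<open>Structure invariants for chosen orderings\<close>

lemma block_lists_ornament_orderings:
  assumes "ornament_orderings T \<delta> os rs"
  shows "block_lists pi0 os rs"
  using assms by unfold_locales (auto simp: ornament_orderings_def)

lemma set_ornament_orderings:
  assumes "ornament_orderings T \<delta> os rs"
  shows "set (concat (map rs os)) = nbr_refinement T \<delta> ` pverts T"
proof -
  have "set (concat (map rs os)) = {x \<in> nbr_refinement T \<delta> ` pverts T. pi0 x \<in> \<delta> ` pverts T}"
    using assms by (auto simp: ornament_orderings_def)
  then show ?thesis by auto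
qed

lemma structure_invariant_carrier:
  "structure_invariant T \<delta> os rs \<in> carrier_mat (length (concat (map rs os))) (length (concat (map rs os)))"
  by (simp add: structure_invariant_def Let_def)

lemma structure_invariant_index:
  assumes "i < length (concat (map rs os))" "j < length (concat (map rs os))"
  shows "structure_invariant T \<delta> os rs $$ (i, j) =
    (adjacency_number T \<delta> (concat (map rs os) ! i) (concat (map rs os) ! j),
     pi0 (concat (map rs os) ! i), pi0 (concat (map rs os) ! j))"
  using assms by (simp add: structure_invariant_def Let_def)

lemma row_ornament_structure_invariant:
  assumes "i < length (concat (map rs os))"
  shows "row_ornament (structure_invariant T \<delta> os rs) i = pi0 (concat (map rs os) ! i)"
  using assms by (simp add: row_ornament_def structure_invariant_index del: length_concat)

text \<open>Serves two purposes: comparing two orderings for one tree, and comparing two trees with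
  the same adjacency numbers.\<close>

lemma permuted_structure_invariant:
  fixes os os' :: "'o list" and rs rs' :: "'o \<Rightarrow> 'o ornament list"
  defines "xs \<equiv> concat (map rs os)" and "ys \<equiv> concat (map rs' os')"
  assumes "length xs = length ys" "p permutes {..<length xs}" "\<And>i. i < length xs \<Longrightarrow> ys ! p i = xs ! i"
    and "adjacency_number T' \<delta>' = adjacency_number T \<delta>"
  shows "permuted_by p (structure_invariant T \<delta> os rs) (structure_invariant T' \<delta>' os' rs')"
proof -
  have "p i < length ys" if "i < length xs" for i
    using permutes_in_image[OF assms(4), of i] that assms(3) by simp
  then show ?thesis
    unfolding permuted_by_def
    using assms(3-6) structure_invariant_carrier[of T \<delta> os rs] structure_invariant_carrier[of T' \<delta>' os' rs']
    unfolding xs_def ys_def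
    by (intro exI[of _ "length (concat (map rs os))"])
      (simp add: structure_invariant_index del: length_concat)
qed

section \<open>The two implications\<close>

text \<open>Along an isomorphism the ornaments and adjacency numbers coincide, so only the orderings
  differ. The change of orderings is split in two: \<open>p\<close> reorders whole blocks, then
  \<open>q\<close> reorders inside the blocks.\<close>

lemma equal_structure_invariants_of_isomorphism:
  assumes "tree_isomorphism T T' \<phi>" "decoration_preserving T \<delta> \<delta>' \<phi>"
    and o: "ornament_orderings T \<delta> os rs" and o': "ornament_orderings T' \<delta>' os' rs'"
  shows "equal_up_to_block_permutation
    (structure_invariant T \<delta> os rs) (structure_invariant T' \<delta>' os' rs')"
proof -
  have img: "nbr_refinement T' \<delta>' ` pverts T' = nbr_refinement T \<delta> ` pverts T"
    using assms(1,2) by (rule nbr_refinement_image_isomorphism)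
  have "\<delta>' ` pverts T' = pi0 ` nbr_refinement T' \<delta>' ` pverts T'"
    by (simp add: image_image)
  also have "\<dots> = \<delta> ` pverts T"
    by (simp add: img image_image)
  finally have os: "set os = set os'"
    using o o' by (simp add: ornament_orderings_def)
  \<comment> \<open>The intermediate choice takes the order of blocks from the second tree and the
    order inside blocks from the first.\<close>
  have mid: "ornament_orderings T \<delta> os' rs"
    using o o' os by (simp add: ornament_orderings_def)
  let ?C = "structure_invariant T \<delta> os' rs"
  define xs where "xs = concat (map rs os)"
  define ys where "ys = concat (map rs os')"
  define zs where "zs = concat (map rs' os')"
  note bx = block_lists_ornament_orderings[OF o]
    and bys = block_lists_ornament_orderings[OF mid]
    and bz = block_lists_ornament_orderings[OF o']
  have dist: "distinct xs" "distinct ys" "distinct zs"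
    unfolding xs_def ys_def zs_def using bx bys bz by (simp_all only: block_lists.distinct_blocks)
  have sets: "set xs = set ys" "set ys = set zs"
    unfolding xs_def ys_def zs_def
    using set_ornament_orderings[OF o] set_ornament_orderings[OF mid] set_ornament_orderings[OF o'] img
    by simp_all
  have len: "length xs = length ys" "length ys = length zs"
    using dist sets distinct_card by metis+
  obtain p where p: "p permutes {..<length xs}" "\<And>i. i < length xs \<Longrightarrow> ys ! p i = xs ! i"
    using reordering_permutation[OF dist(1,2) sets(1)] by blast
  obtain q where q: "q permutes {..<length ys}" "\<And>i. i < length ys \<Longrightarrow> zs ! q i = ys ! i"
    using reordering_permutation[OF dist(2,3) sets(2)] by blast
  have p_less: "p i < length ys" if "i < length xs" for i
    using permutes_in_image[OF p(1), of i] that len by simp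
  have q_less: "q i < length ys" if "i < length ys" for i
    using permutes_in_image[OF q(1), of i] that by simp
  \<comment> \<open>Blocks of equal length in the same order give equal ornaments at each position,
    so \<open>q\<close> cannot leave a block.\<close>
  have "length (rs c) = length (rs' c)" if "c \<in> set os'" for c
  proof -
    have "set (rs c) = {x \<in> nbr_refinement T \<delta> ` pverts T. pi0 x = c}" "distinct (rs c)"
      using mid that unfolding ornament_orderings_def by blast+
    moreover have "set (rs' c) = {x \<in> nbr_refinement T' \<delta>' ` pverts T'. pi0 x = c}" "distinct (rs' c)"
      using o' that unfolding ornament_orderings_def by blast+
    ultimately have "set (rs c) = set (rs' c)" "distinct (rs c)" "distinct (rs' c)"
      by (simp_all add: img)
    then show ?thesis by (metis distinct_card)
  qed
  then have "map pi0 ys = map pi0 zs"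
    unfolding ys_def zs_def block_lists.map_key_blocks[OF bys] block_lists.map_key_blocks[OF bz]
    by (simp cong: map_cong)
  then have key: "pi0 (ys ! i) = pi0 (zs ! i)" if "i < length ys" for i
    using that len by (metis nth_map)
  have "permutes_blocks p (structure_invariant T \<delta> os rs)"
    unfolding permutes_blocks_def
  proof (intro allI impI)
    fix i assume i: "Suc i < dim_row (structure_invariant T \<delta> os rs)"
      and r: "row_ornament (structure_invariant T \<delta> os rs) (Suc i) =
        row_ornament (structure_invariant T \<delta> os rs) i"
    have i': "Suc i < length xs"
      using i structure_invariant_carrier[of T \<delta> os rs] by (simp add: xs_def)
    then have "pi0 (xs ! Suc i) = pi0 (xs ! i)"
      using r unfolding xs_def by (simp add: row_ornament_structure_invariant del: length_concat)
    with i' show "p (Suc i) = Suc (p i)"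
      using p(2)[of i] p(2)[of "Suc i"] p_less[of i] p_less[of "Suc i"] unfolding xs_def ys_def
      by (intro consecutive_in_reordered_blocks[OF bx bys os]) auto
  qed
  moreover have "permuted_by p (structure_invariant T \<delta> os rs) ?C"
    by (rule permuted_structure_invariant[OF len(1)[unfolded xs_def ys_def]
          p[unfolded xs_def ys_def]]) simp_all
  moreover have "permutes_within_blocks q ?C"
    unfolding permutes_within_blocks_def
  proof (intro allI impI)
    fix i assume "i < dim_row ?C"
    then have i: "i < length ys"
      using structure_invariant_carrier[of T \<delta> os' rs] by (simp add: ys_def)
    have "pi0 (ys ! q i) = pi0 (ys ! i)"
      using key[OF q_less[OF i]] q(2)[OF i] by simp
    then show "row_ornament ?C (q i) = row_ornament ?C i"
      using i q_less[OF i] unfolding ys_def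
      by (simp add: row_ornament_structure_invariant del: length_concat)
  qed
  moreover have "permuted_by q ?C (structure_invariant T' \<delta>' os' rs')"
    by (rule permuted_structure_invariant[OF len(2)[unfolded ys_def zs_def]
          q[unfolded ys_def zs_def] adjacency_number_isomorphism[OF assms(1,2)]])
  ultimately show ?thesis
    unfolding equal_up_to_block_permutation_def
    by (intro exI[of _ ?C] exI[of _ p] exI[of _ q] conjI)
qed

lemma permuted_by_comp:
  assumes "permuted_by p A B" "permuted_by q B C"
  shows "permuted_by (q \<circ> p) A C"
proof -
  obtain n where n: "A \<in> carrier_mat n n" "B \<in> carrier_mat n n" "p permutes {..<n}"
    "\<And>i j. i < n \<Longrightarrow> j < n \<Longrightarrow> B $$ (p i, p j) = A $$ (i, j)"
    using assms(1) by (auto simp: permuted_by_def)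
  moreover obtain m where m: "B \<in> carrier_mat m m" "C \<in> carrier_mat m m" "q permutes {..<m}"
    "\<And>i j. i < m \<Longrightarrow> j < m \<Longrightarrow> C $$ (q i, q j) = B $$ (i, j)"
    using assms(2) by (auto simp: permuted_by_def)
  moreover have "m = n" using n(2) m(1) by auto
  moreover have "p i < n" if "i < n" for i
    using permutes_in_image[OF n(3), of i] that by simp
  ultimately show ?thesis
    unfolding permuted_by_def by (intro exI[of _ n]) (auto intro: permutes_compose)
qed

text \<open>Matching entries turn the permutation of indices into a renaming of refined ornaments
  that respects both the underlying ornaments and the adjacency numbers.\<close>

lemma isomorphism_of_equal_structure_invariants:
  assumes act: "cocompact_tree_action G T \<alpha>" and inv: "invariant_decoration G T \<alpha> \<delta>"
    and act': "cocompact_tree_action G' T' \<alpha>'" and inv': "invariant_decoration G' T' \<alpha>' \<delta>'"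
    and o: "ornament_orderings T \<delta> os rs" and o': "ornament_orderings T' \<delta>' os' rs'"
    and perm: "permuted_by p (structure_invariant T \<delta> os rs) (structure_invariant T' \<delta>' os' rs')"
  shows "\<exists>\<phi>. tree_isomorphism T T' \<phi> \<and> decoration_preserving T \<delta> \<delta>' \<phi>"
proof -
  define xs where "xs = concat (map rs os)"
  define ys where "ys = concat (map rs' os')"
  let ?d = "nbr_refinement T \<delta>" and ?d' = "nbr_refinement T' \<delta>'"
  have dist: "distinct xs" "distinct ys"
    unfolding xs_def ys_def
    using block_lists_ornament_orderings[OF o] block_lists_ornament_orderings[OF o']
    by (simp_all only: block_lists.distinct_blocks)
  have sets: "set xs = ?d ` pverts T" "set ys = ?d' ` pverts T'"
    unfolding xs_def ys_def by (fact set_ornament_orderings[OF o] set_ornament_orderings[OF o'])+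
  obtain n where n: "structure_invariant T \<delta> os rs \<in> carrier_mat n n"
    "structure_invariant T' \<delta>' os' rs' \<in> carrier_mat n n" and p: "p permutes {..<n}"
    and entries: "\<And>i j. i < n \<Longrightarrow> j < n \<Longrightarrow> structure_invariant T' \<delta>' os' rs' $$ (p i, p j) =
      structure_invariant T \<delta> os rs $$ (i, j)"
    using perm by (auto simp: permuted_by_def)
  have len: "length xs = n" "length ys = n"
    using n structure_invariant_carrier[of T \<delta> os rs] structure_invariant_carrier[of T' \<delta>' os' rs']
    unfolding xs_def ys_def by auto
  have p_less: "p i < n" if "i < n" for i
    using permutes_in_image[OF p, of i] that by simp
  \<comment> \<open>The renaming finds the index of an ornament in \<open>xs\<close> and returns the
    ornament of the second tree at the permuted index.\<close>
  define \<beta> where "\<beta> = (\<lambda>i. ys ! p i) \<circ> the_inv_into {..<n} ((!) xs)"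
  have xs_bij: "bij_betw ((!) xs) {..<n} (set xs)" using dist(1) len(1) by (intro bij_betw_nth) auto
  have ys_bij: "bij_betw ((!) ys) {..<n} (set ys)" using dist(2) len(2) by (intro bij_betw_nth) auto
  have \<beta>_nth: "\<beta> (xs ! i) = ys ! p i" if "i < n" for i
    using that the_inv_into_f_f[OF bij_betw_imp_inj_on[OF xs_bij]] by (simp add: \<beta>_def)
  have "bij_betw ((!) ys \<circ> p) {..<n} (set ys)"
    using permutes_imp_bij[OF p] ys_bij by (rule bij_betw_trans)
  then have \<beta>_bij: "bij_betw \<beta> (set xs) (set ys)"
    unfolding \<beta>_def using bij_betw_the_inv_into[OF xs_bij]
    by (intro bij_betw_trans[of _ _ "{..<n}"]) (auto simp: comp_def)
  have \<beta>: "pi0 (\<beta> x) = pi0 x \<and> adjacency_number T' \<delta>' (\<beta> x) (\<beta> y) = adjacency_number T \<delta> x y"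
    if xy: "x \<in> set xs" "y \<in> set xs" for x y
  proof -
    obtain i j where ij: "i < n" "x = xs ! i" "j < n" "y = xs ! j"
      using xy len by (metis in_set_conv_nth)
    then show ?thesis
      using entries[OF ij(1,3)] p_less[OF ij(1)] p_less[OF ij(3)] len \<beta>_nth[OF ij(1)] \<beta>_nth[OF ij(3)]
      unfolding xs_def ys_def by (simp add: structure_invariant_index del: length_concat)
  qed
  \<comment> \<open>Recolouring the first tree by \<beta> gives both trees the same palette. By
    stability the counts are adjacency numbers, and these agree under \<beta>.\<close>
  have "\<exists>\<phi>. tree_isomorphism T T' \<phi> \<and> decoration_preserving T (\<beta> \<circ> ?d) ?d' \<phi>"
  proof (rule isomorphism_of_equal_nbr_counts)
    show "(\<beta> \<circ> ?d) ` pverts T = ?d' ` pverts T'"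
      using bij_betw_imp_surj_on[OF \<beta>_bij] sets by (simp add: image_comp)
    fix v v' c assume v: "v \<in> pverts T" "v' \<in> pverts T'" "?d' v' = (\<beta> \<circ> ?d) v"
    show "nbr_count T (\<beta> \<circ> ?d) v c = nbr_count T' ?d' v' c"
    proof (cases "c \<in> set ys")
      case True
      then obtain x where x: "x \<in> set xs" "c = \<beta> x"
        using bij_betw_imp_surj_on[OF \<beta>_bij] by auto
      have dv: "?d v \<in> set xs" using v(1) sets by simp
      have "nbr_count T (\<beta> \<circ> ?d) v c = nbr_count T ?d v x"
      proof (rule nbr_count_cong)
        fix w assume "w \<in> pverts T"
        then have "?d w \<in> set xs" using sets by simp
        then show "(\<beta> \<circ> ?d) w = c \<longleftrightarrow> ?d w = x"
          using inj_on_eq_iff[OF bij_betw_imp_inj_on[OF \<beta>_bij]] x by simp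
      qed
      also have "\<dots> = adjacency_number T \<delta> x (?d v)"
        by (rule adjacency_number_nbr_refinement[OF act inv v(1), symmetric])
      also have "\<dots> = adjacency_number T' \<delta>' c (?d' v')"
        using \<beta>[OF x(1) dv] x(2) v(3) by simp
      also have "\<dots> = nbr_count T' ?d' v' c"
        by (rule adjacency_number_nbr_refinement[OF act' inv' v(2)])
      finally show ?thesis .
    next
      \<comment> \<open>A colour outside the palette occurs at no vertex, so both counts are
        0.\<close>
      case False
      moreover have "(\<beta> \<circ> ?d) ` pverts T = set ys"
        using bij_betw_imp_surj_on[OF \<beta>_bij] sets by (simp add: image_comp)
      ultimately show ?thesis
        using sets nbr_count_eq_0 by metis
    qed
  qed (use act act' in \<open>auto simp: cocompact_tree_action_def\<close>)
  then obtain \<phi> where \<phi>: "tree_isomorphism T T' \<phi>" "\<And>v. v \<in> pverts T \<Longrightarrow> ?d' (\<phi> v) = \<beta> (?d v)"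
    by (auto simp: decoration_preserving_def)
  \<comment> \<open>The isomorphism respects refined ornaments only up to \<beta>; since \<beta>
    commutes with \<open>pi0\<close>, the original decorations are preserved exactly.\<close>
  have "\<delta>' (\<phi> v) = \<delta> v" if v: "v \<in> pverts T" for v
  proof -
    have "?d v \<in> set xs" using v sets by simp
    then have "pi0 (\<beta> (?d v)) = pi0 (?d v)" using \<beta> by blast
    then show ?thesis unfolding \<phi>(2)[OF v, symmetric] by simp
  qed
  with \<phi>(1) show ?thesis by (auto simp: decoration_preserving_def)
qed

theorem proposition4p7:
  fixes G :: "('g, 'm) monoid_scheme" and T :: "'v pair_pre_digraph"
    and \<alpha> :: "'g \<Rightarrow> 'v \<Rightarrow> 'v" and \<delta> :: "'v \<Rightarrow> 'o"
    and G' :: "('h, 'n) monoid_scheme" and T' :: "'w pair_pre_digraph"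
    and \<alpha>' :: "'h \<Rightarrow> 'w \<Rightarrow> 'w" and \<delta>' :: "'w \<Rightarrow> 'o"
    and os os' :: "'o list" and rs rs' :: "'o \<Rightarrow> 'o ornament list"
  assumes "cocompact_tree_action G T \<alpha>" and "invariant_decoration G T \<alpha> \<delta>"
    and "cocompact_tree_action G' T' \<alpha>'" and "invariant_decoration G' T' \<alpha>' \<delta>'"
    and "ornament_orderings T \<delta> os rs" and "ornament_orderings T' \<delta>' os' rs'"
  shows "(\<exists>\<phi>. tree_isomorphism T T' \<phi> \<and> decoration_preserving T \<delta> \<delta>' \<phi>) \<longleftrightarrow>
         equal_up_to_block_permutation
           (structure_invariant T \<delta> os rs) (structure_invariant T' \<delta>' os' rs')"
proof
  assume "\<exists>\<phi>. tree_isomorphism T T' \<phi> \<and> decoration_preserving T \<delta> \<delta>' \<phi>"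
  then obtain \<phi> where "tree_isomorphism T T' \<phi>" "decoration_preserving T \<delta> \<delta>' \<phi>" by blast
  then show "equal_up_to_block_permutation
      (structure_invariant T \<delta> os rs) (structure_invariant T' \<delta>' os' rs')"
    using assms(5,6) by (rule equal_structure_invariants_of_isomorphism)
next
  assume "equal_up_to_block_permutation
      (structure_invariant T \<delta> os rs) (structure_invariant T' \<delta>' os' rs')"
  then obtain C p q where "permuted_by p (structure_invariant T \<delta> os rs) C"
    "permuted_by q C (structure_invariant T' \<delta>' os' rs')"
    unfolding equal_up_to_block_permutation_def by blast
  then have "permuted_by (q \<circ> p) (structure_invariant T \<delta> os rs) (structure_invariant T' \<delta>' os' rs')"
    by (rule permuted_by_comp)
  then show "\<exists>\<phi>. tree_isomorphism T T' \<phi> \<and> decoration_preserving T \<delta> \<delta>' \<phi>"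
    by (rule isomorphism_of_equal_structure_invariants[OF assms])
qed

end
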